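(* Let $K$ be a field of characteristic zero, let $m,n\ge 1$, and let $\mathbb{X}\subseteq\mathbb{P}^m\times\mathbb{P}^n$ be a nonempty finite set of points over $K$ which has the $(\star)$-property. Write $\mathbb{X}_1=\pi_1(\mathbb{X})=\{q_1,\dots,q_{s_1}\}\subseteq\mathbb{P}^m$ and $\mathbb{X}_2=\pi_2(\mathbb{X})=\{q'_1,\dots,q'_{s_2}\}\subseteq\mathbb{P}^n$ (distinct points), and put $$W_i:=\pi_2(\pi_1^{-1}(q_i)\cap\mathbb{X})\subseteq\mathbb{X}_2,\qquad V_j:=\pi_1(\pi_2^{-1}(q'_j)\cap\mathbb{X})\subseteq\mathbb{X}_1$$ for $i=1,\dots,s_1$ and $j=1,\dots,s_2$. Then $\mathbb{X}$ has the Cayley-Bacharach property if and only if the following conditions are satisfied: (a) $V_1,\dots,V_{s_2}$ are Cayley-Bacharach schemes in $\mathbb{P}^m$ and $r_{V_1}=\cdots=r_{V_{s_2}}$; (b) $W_1,\dots,W_{s_1}$ are Cayley-Bacharach schemes in $\mathbb{P}^n$ and $r_{W_1}=\cdots=r_{W_{s_1}}$.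
   Context: Points have coordinates in $K$; $\pi_1,\pi_2$ are the canonical projections of $\mathbb{P}^m\times\mathbb{P}^n$ to $\mathbb{P}^m$, $\mathbb{P}^n$. $(\star)$-property: whenever $q_1\times q'_1,\ q_2\times q'_2\in\mathbb{X}$, then also $q_1\times q'_2\in\mathbb{X}$ or $q_2\times q'_1\in\mathbb{X}$. The Hilbert function of a finite set $\mathbb{X}\subseteq\mathbb{P}^m\times\mathbb{P}^n$ is $\operatorname{HF}_{\mathbb{X}}(i,j)=\dim_K(S/I_{\mathbb{X}})_{i,j}$, where $S=K[X_0,\dots,X_m,Y_0,\dots,Y_n]$ with $\deg X_i=(1,0)$, $\deg Y_j=(0,1)$ and $I_{\mathbb{X}}$ is the bihomogeneous vanishing ideal. $\mathbb{X}$ has the Cayley-Bacharach property if the Hilbert function of $\mathbb{X}\setminus\{p\}$ is independent of the choice of $p\in\mathbb{X}$. For a nonempty finite set $V$ of points in a projective space: $\operatorname{HF}_V$ is the Hilbert function of its homogeneous coordinate ring, and its regularity index $r_V$ is the least integer $i_0$ with $\operatorname{HF}_V(i)=|V|$ for all $i\ge i_0$. A minimal separator of $p\in V$ is a homogeneous form $F$ of minimal degree with $F(p)\ne0$ and $F(p')=0$ for all $p'\in V\setminus\{p\}$; its degree is $\deg_V(p)$. $V$ is a Cayley-Bacharach scheme if $\deg_V(p)=r_V$ for all $p\in V$. *)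

theory Defs
  imports
    "HOL-Library.Poly_Mapping"
    "HOL-Algebra.Ideal"
    "HOL-Algebra.QuotRing"
    "HOL-Algebra.Embedded_Algebras"
begin

section \<open>Projective spaces\<close>

text \<open>
  Coordinate vectors of \<open>K\<^sup>m\<^sup>+\<^sup>1\<close> are functions on the naturals that vanish beyond index \<open>m\<close>.
  A point of projective \<open>m\<close>-space is an equivalence class of nonzero coordinate vectors modulo
  nonzero scalars, i.e. the set of all its homogeneous coordinate vectors.
\<close>

type_synonym 'k point = "(nat \<Rightarrow> 'k) set"

definition coord_vectors :: "nat \<Rightarrow> (nat \<Rightarrow> 'k::field) set" where
  "coord_vectors m = {v. (\<forall>i>m. v i = 0) \<and> (\<exists>i\<le>m. v i \<noteq> 0)}"

definition proj_rel :: "nat \<Rightarrow> ((nat \<Rightarrow> 'k::field) \<times> (nat \<Rightarrow> 'k)) set" where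
  "proj_rel m = {(v, w). v \<in> coord_vectors m \<and> w \<in> coord_vectors m \<and>
                         (\<exists>c. c \<noteq> 0 \<and> w = (\<lambda>i. c * v i))}"

definition proj_space :: "nat \<Rightarrow> 'k::field point set" where
  "proj_space m = coord_vectors m // proj_rel m"


section \<open>Polynomial rings\<close>

type_synonym ('v, 'k) mpoly = "('v \<Rightarrow>\<^sub>0 nat) \<Rightarrow>\<^sub>0 'k"

text \<open>The polynomial ring over the field \<open>'k\<close> with set of indeterminates \<open>I\<close>.\<close>

definition poly_ring :: "'v set \<Rightarrow> ('v, 'k::field) mpoly ring" where
  "poly_ring I = \<lparr>carrier = {F. \<forall>t \<in> Poly_Mapping.keys F. Poly_Mapping.keys t \<subseteq> I},
                  mult = (*), one = 1, zero = 0, add = (+)\<rparr>"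

definition Const :: "'k::field \<Rightarrow> ('v, 'k) mpoly" where
  "Const c = Poly_Mapping.single 0 c"

definition poly_eval :: "('v \<Rightarrow> 'k::field) \<Rightarrow> ('v, 'k) mpoly \<Rightarrow> 'k" where
  "poly_eval a F = (\<Sum>t \<in> Poly_Mapping.keys F. Poly_Mapping.lookup F t *
                      (\<Prod>x \<in> Poly_Mapping.keys t. a x ^ Poly_Mapping.lookup t x))"

lemma cring_poly_ring: "cring (poly_ring I :: ('v, 'k::field) mpoly ring)"
proof (rule cringI)
  show "abelian_group (poly_ring I :: ('v, 'k) mpoly ring)"
  proof (rule abelian_groupI)
    fix F G :: "('v, 'k) mpoly"
    assume "F \<in> carrier (poly_ring I)" "G \<in> carrier (poly_ring I)"
    then show "F \<oplus>\<^bsub>poly_ring I\<^esub> G \<in> carrier (poly_ring I)"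
      using Poly_Mapping.keys_add[of F G] by (fastforce simp: poly_ring_def)
  next
    fix F :: "('v, 'k) mpoly"
    assume F: "F \<in> carrier (poly_ring I)"
    show "\<exists>G \<in> carrier (poly_ring I). G \<oplus>\<^bsub>poly_ring I\<^esub> F = \<zero>\<^bsub>poly_ring I\<^esub>"
      using F by (intro bexI[of _ "- F"]) (auto simp: poly_ring_def)
  qed (auto simp: poly_ring_def algebra_simps)
next
  show "Group.comm_monoid (poly_ring I :: ('v, 'k) mpoly ring)"
  proof (rule comm_monoidI)
    fix F G :: "('v, 'k) mpoly"
    assume FG: "F \<in> carrier (poly_ring I)" "G \<in> carrier (poly_ring I)"
    have "Poly_Mapping.keys t \<subseteq> I" if t: "t \<in> Poly_Mapping.keys (F * G)" for t
    proof -
      obtain a b where ab: "t = a + b" "a \<in> Poly_Mapping.keys F" "b \<in> Poly_Mapping.keys G"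
        using Poly_Mapping.keys_mult[of F G] t by blast
      then have "Poly_Mapping.keys a \<subseteq> I" "Poly_Mapping.keys b \<subseteq> I"
        using FG by (auto simp: poly_ring_def)
      then show ?thesis
        using Poly_Mapping.keys_add[of a b] ab(1) by blast
    qed
    then show "F \<otimes>\<^bsub>poly_ring I\<^esub> G \<in> carrier (poly_ring I)"
      by (auto simp: poly_ring_def)
  qed (auto simp: poly_ring_def algebra_simps)
qed (auto simp: poly_ring_def algebra_simps)

text \<open>
  The dimension over \<open>'k\<close> of the image of \<open>E\<close> in the residue class ring modulo \<open>J\<close>. If \<open>E\<close> is the
  space of forms of a given degree and \<open>J\<close> a homogeneous ideal, this image is the graded piece of
  the residue class ring in that degree. The field \<open>'k\<close> acts through the classes of the constants.
\<close>

definition residue_dim ::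
  "'v set \<Rightarrow> ('v, 'k::field) mpoly set \<Rightarrow> ('v, 'k) mpoly set \<Rightarrow> nat" where
  "residue_dim I J E =
     ring.dim (poly_ring I Quot J)
       ((\<lambda>c. J +>\<^bsub>poly_ring I\<^esub> Const c) ` UNIV)
       ((\<lambda>F. J +>\<^bsub>poly_ring I\<^esub> F) ` E)"


section \<open>Finite sets of points in a projective space\<close>

definition forms :: "nat \<Rightarrow> nat \<Rightarrow> (nat, 'k::field) mpoly set" where
  "forms m d = {F \<in> carrier (poly_ring {..m}).
     \<forall>t \<in> Poly_Mapping.keys F. (\<Sum>k\<le>m. Poly_Mapping.lookup t k) = d}"

text \<open>
  The following is only used for forms, for which vanishing does not depend on the choice of the
  homogeneous coordinate vector of the point.
\<close>

definition vanishes_at :: "(nat, 'k::field) mpoly \<Rightarrow> 'k point \<Rightarrow> bool" where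
  "vanishes_at F p \<longleftrightarrow> (\<forall>v \<in> p. poly_eval v F = 0)"

definition vanishing_ideal :: "nat \<Rightarrow> 'k::field point set \<Rightarrow> (nat, 'k) mpoly set" where
  "vanishing_ideal m V =
     Idl\<^bsub>poly_ring {..m}\<^esub> {F. (\<exists>d. F \<in> forms m d) \<and> (\<forall>p \<in> V. vanishes_at F p)}"

definition HF :: "nat \<Rightarrow> 'k::field point set \<Rightarrow> nat \<Rightarrow> nat" where
  "HF m V i = residue_dim {..m} (vanishing_ideal m V) (forms m i)"

definition reg_index :: "nat \<Rightarrow> 'k::field point set \<Rightarrow> nat" where
  "reg_index m V = (LEAST i0. \<forall>i\<ge>i0. HF m V i = card V)"

definition separator :: "nat \<Rightarrow> 'k::field point set \<Rightarrow> 'k point \<Rightarrow> nat \<Rightarrow> (nat, 'k) mpoly \<Rightarrow> bool" where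
  "separator m V p d F \<longleftrightarrow>
     F \<in> forms m d \<and> \<not> vanishes_at F p \<and> (\<forall>p' \<in> V - {p}. vanishes_at F p')"

text \<open>The degree of a minimal separator.\<close>

definition sep_degree :: "nat \<Rightarrow> 'k::field point set \<Rightarrow> 'k point \<Rightarrow> nat" where
  "sep_degree m V p = (LEAST d. \<exists>F. separator m V p d F)"

definition CB_scheme :: "nat \<Rightarrow> 'k::field point set \<Rightarrow> bool" where
  "CB_scheme m V \<longleftrightarrow> (\<forall>p \<in> V. sep_degree m V p = reg_index m V)"


section \<open>Finite sets of points in a product of two projective spaces\<close>

text \<open>The indeterminates are \<open>X\<^sub>i = Inl i\<close> for \<open>i \<le> m\<close> and \<open>Y\<^sub>j = Inr j\<close> for \<open>j \<le> n\<close>.\<close>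

definition bivars :: "nat \<Rightarrow> nat \<Rightarrow> (nat + nat) set" where
  "bivars m n = {..m} <+> {..n}"

definition biforms :: "nat \<Rightarrow> nat \<Rightarrow> nat \<Rightarrow> nat \<Rightarrow> (nat + nat, 'k::field) mpoly set" where
  "biforms m n i j = {F \<in> carrier (poly_ring (bivars m n)).
     \<forall>t \<in> Poly_Mapping.keys F. (\<Sum>k\<le>m. Poly_Mapping.lookup t (Inl k)) = i \<and>
                               (\<Sum>k\<le>n. Poly_Mapping.lookup t (Inr k)) = j}"

definition bivanishes_at :: "(nat + nat, 'k::field) mpoly \<Rightarrow> 'k point \<times> 'k point \<Rightarrow> bool" where
  "bivanishes_at F p \<longleftrightarrow> (\<forall>v \<in> fst p. \<forall>w \<in> snd p. poly_eval (case_sum v w) F = 0)"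

definition bivanishing_ideal ::
  "nat \<Rightarrow> nat \<Rightarrow> ('k::field point \<times> 'k point) set \<Rightarrow> (nat + nat, 'k) mpoly set" where
  "bivanishing_ideal m n X =
     Idl\<^bsub>poly_ring (bivars m n)\<^esub>
       {F. (\<exists>i j. F \<in> biforms m n i j) \<and> (\<forall>p \<in> X. bivanishes_at F p)}"

definition biHF :: "nat \<Rightarrow> nat \<Rightarrow> ('k::field point \<times> 'k point) set \<Rightarrow> nat \<Rightarrow> nat \<Rightarrow> nat" where
  "biHF m n X i j = residue_dim (bivars m n) (bivanishing_ideal m n X) (biforms m n i j)"

definition CB_property :: "nat \<Rightarrow> nat \<Rightarrow> ('k::field point \<times> 'k point) set \<Rightarrow> bool" where
  "CB_property m n X \<longleftrightarrow> (\<forall>p \<in> X. \<forall>p' \<in> X. biHF m n (X - {p}) = biHF m n (X - {p'}))"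

definition star_property :: "('k point \<times> 'k point) set \<Rightarrow> bool" where
  "star_property X \<longleftrightarrow>
     (\<forall>q1 q1' q2 q2'. (q1, q1') \<in> X \<and> (q2, q2') \<in> X \<longrightarrow> (q1, q2') \<in> X \<or> (q2, q1') \<in> X)"

definition fibre1 :: "('k point \<times> 'k point) set \<Rightarrow> 'k point \<Rightarrow> 'k point set" where
  "fibre1 X q = snd ` (fst -` {q} \<inter> X)"

definition fibre2 :: "('k point \<times> 'k point) set \<Rightarrow> 'k point \<Rightarrow> 'k point set" where
  "fibre2 X q' = fst ` (snd -` {q'} \<inter> X)"

end

theory Submission
  imports Defs
begin

text \<open>
  For a point \<open>(q, q')\<close> of \<open>X\<close>, removing it lowers the Hilbert function by one exactly in those
  bidegrees \<open>(i, j)\<close> in which it has a separator, i.e. a biform that vanishes on \<open>X - {(q, q')}\<close> but not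
  at \<open>(q, q')\<close> (\<open>biHF_remove_point\<close>). Hence the Cayley-Bacharach property says that the set of
  separator bidegrees is the same for all points of \<open>X\<close>.

  Under the star property this set is the quadrant \<open>i \<ge> a, j \<ge> b\<close>, where \<open>a\<close> is the degree of a
  minimal separator of \<open>q\<close> in the fibre through \<open>(q, q')\<close> over \<open>q'\<close>, and \<open>b\<close> the degree of a minimal
  separator of \<open>q'\<close> in the fibre over \<open>q\<close> (\<open>biseparator_exists_iff\<close>). Indeed a separator of \<open>(q, q')\<close>
  restricts to separators in both fibres. Conversely, take the product \<open>G(x) H(y)\<close> of separators in the
  two fibres: if \<open>(r, r')\<close> is another point of \<open>X\<close>, the star property puts \<open>(r, q')\<close> or \<open>(q, r')\<close>
  into \<open>X\<close>, and so \<open>G(r) = 0\<close> or \<open>H(r') = 0\<close>.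

  Thus \<open>X\<close> has the Cayley-Bacharach property iff \<open>a\<close> and \<open>b\<close> are constant on \<open>X\<close>
  (\<open>CB_property_iff\<close>). The regularity index of a finite set of points is the maximal degree of its
  minimal separators (\<open>reg_index_eq_Max\<close>), because the Hilbert function takes the value \<open>card V\<close> in
  degree \<open>d\<close> iff every point has a separator of degree \<open>d\<close>. So constancy of \<open>a\<close> is the condition
  on the sets \<open>V j\<close>, and constancy of \<open>b\<close> the condition on the sets \<open>W i\<close>
  (\<open>CB_schemes_equal_reg_index_iff\<close>).

  Dimensions of graded pieces of residue class rings are accessed through interpolation bases: maximal
  sets \<open>B\<close> of points at which the forms under consideration take arbitrary values. The size of such a
  set is the rank of the evaluation map, and thereby the dimension (\<open>residue_dim_eq_card\<close>).
\<close>


section \<open>Evaluation is a ring homomorphism\<close>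

lemma poly_mapping_add_induct [case_names zero single add]:
  fixes F :: "'a \<Rightarrow>\<^sub>0 'b::ab_group_add"
  assumes "P 0" and "\<And>t c. P (Poly_Mapping.single t c)" and "\<And>F G. P F \<Longrightarrow> P G \<Longrightarrow> P (F + G)"
  shows "P F"
proof (induction F rule: update_induct)
  case const
  show ?case using assms(1) .
next
  case (update F t c)
  have "Poly_Mapping.update t c F = F + Poly_Mapping.single t c"
    using update(1) by (intro poly_mapping_eqI)
      (auto simp: lookup_update lookup_add lookup_single in_keys_iff when_def)
  then show ?case using assms(2,3) update by metis
qed

definition mono_eval :: "('v \<Rightarrow> 'k::field) \<Rightarrow> ('v \<Rightarrow>\<^sub>0 nat) \<Rightarrow> 'k" where
  "mono_eval a t = (\<Prod>x \<in> Poly_Mapping.keys t. a x ^ Poly_Mapping.lookup t x)"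

lemma mono_eval_superset:
  assumes "finite S" "Poly_Mapping.keys t \<subseteq> S"
  shows "mono_eval a t = (\<Prod>x \<in> S. a x ^ Poly_Mapping.lookup t x)"
  unfolding mono_eval_def using assms by (intro prod.mono_neutral_left) (auto simp: in_keys_iff)

lemma mono_eval_add: "mono_eval a (s + t) = mono_eval a s * mono_eval a t"
proof -
  let ?S = "Poly_Mapping.keys s \<union> Poly_Mapping.keys t"
  have "mono_eval a u = (\<Prod>x \<in> ?S. a x ^ Poly_Mapping.lookup u x)"
    if "u \<in> {s, t, s + t}" for u
    using that Poly_Mapping.keys_add[of s t] by (intro mono_eval_superset) auto
  then show ?thesis
    by (simp add: lookup_add power_add prod.distrib)
qed

lemma poly_eval_eq: 
  "poly_eval a F = (\<Sum>t \<in> Poly_Mapping.keys F. Poly_Mapping.lookup F t * mono_eval a t)"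
  by (simp add: poly_eval_def mono_eval_def)

lemma poly_eval_zero [simp]: "poly_eval a 0 = 0"
  by (simp add: poly_eval_def)

lemma poly_eval_single: "poly_eval a (Poly_Mapping.single t c) = c * mono_eval a t"
  by (cases "c = 0") (auto simp: poly_eval_eq)

lemma poly_eval_add [simp]: "poly_eval a (F + G) = poly_eval a F + poly_eval a G"
  unfolding poly_eval_eq
  by (rule setsum_keys_plus_distrib) (auto simp: algebra_simps)

lemma poly_eval_uminus [simp]: "poly_eval a (- F) = - poly_eval a F"
  using poly_eval_add[of a F "- F"] by (simp add: eq_neg_iff_add_eq_0 add.commute)

lemma poly_eval_diff [simp]: "poly_eval a (F - G) = poly_eval a F - poly_eval a G"
  using poly_eval_add[of a F "- G"] by simp

lemma poly_eval_mult [simp]: "poly_eval a (F * G) = poly_eval a F * poly_eval a G"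
proof (induction F rule: poly_mapping_add_induct)
  case (single s c)
  show ?case
  proof (induction G rule: poly_mapping_add_induct)
    case (single t d)
    show ?case by (simp add: mult_single poly_eval_single mono_eval_add)
  qed (auto simp: algebra_simps)
qed (auto simp: algebra_simps)

lemma poly_eval_Const [simp]: "poly_eval a (Const c) = c"
  by (simp add: Const_def poly_eval_single mono_eval_def)

lemma Const_hom:
  "Const (c + d) = Const c + Const d" "Const (c * d) = Const c * Const d"
  "Const 1 = 1" "Const 0 = 0"
  by (auto simp: Const_def single_add mult_single)

lemma poly_eval_one [simp]: "poly_eval a 1 = 1"
  using poly_eval_Const[of a 1] by (simp add: Const_hom)

lemma poly_eval_power [simp]: "poly_eval a (F ^ n) = poly_eval a F ^ n"
  by (induction n) auto

lemma poly_eval_sum: "poly_eval a (sum f S) = (\<Sum>x\<in>S. poly_eval a (f x))"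
  by (induction S rule: infinite_finite_induct) auto

lemma poly_eval_prod: "poly_eval a (prod f S) = (\<Prod>x\<in>S. poly_eval a (f x))"
  by (induction S rule: infinite_finite_induct) auto

definition Var :: "'v \<Rightarrow> ('v, 'k::field) mpoly" where
  "Var x = Poly_Mapping.single (Poly_Mapping.single x 1) 1"

lemma poly_eval_Var [simp]: "poly_eval a (Var x) = a x"
  by (simp add: Var_def poly_eval_single mono_eval_def)


section \<open>Substitution and weighted homogeneity\<close>

text \<open>
  Forms on a projective space and forms in one of the two groups of variables of a product are both
  homogeneous with respect to a suitable weight function on the variables, so that the closure
  properties need to be shown only once.
\<close>

definition weight :: "('v \<Rightarrow> nat) \<Rightarrow> ('v \<Rightarrow>\<^sub>0 nat) \<Rightarrow> nat" where
  "weight wt t = (\<Sum>x \<in> Poly_Mapping.keys t. wt x * Poly_Mapping.lookup t x)"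

lemma weight_superset:
  assumes "finite S" "Poly_Mapping.keys t \<subseteq> S"
  shows "weight wt t = (\<Sum>x \<in> S. wt x * Poly_Mapping.lookup t x)"
  unfolding weight_def using assms by (intro sum.mono_neutral_left) (auto simp: in_keys_iff)

lemma weight_add: "weight wt (s + t) = weight wt s + weight wt t"
proof -
  let ?S = "Poly_Mapping.keys s \<union> Poly_Mapping.keys t"
  have "weight wt u = (\<Sum>x \<in> ?S. wt x * Poly_Mapping.lookup u x)" if "u \<in> {s, t, s + t}" for u
    using that Poly_Mapping.keys_add[of s t] by (intro weight_superset) auto
  then show ?thesis
    by (simp add: lookup_add algebra_simps sum.distrib)
qed

definition wforms :: "'v set \<Rightarrow> ('v \<Rightarrow> nat) \<Rightarrow> nat \<Rightarrow> ('v, 'k::field) mpoly set" where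
  "wforms I wt d = {F. \<forall>t \<in> Poly_Mapping.keys F. Poly_Mapping.keys t \<subseteq> I \<and> weight wt t = d}"

lemma wforms_zero: "0 \<in> wforms I wt d"
  by (simp add: wforms_def)

lemma wforms_add: "F \<in> wforms I wt d \<Longrightarrow> G \<in> wforms I wt d \<Longrightarrow> F + G \<in> wforms I wt d"
  using Poly_Mapping.keys_add[of F G] by (fastforce simp: wforms_def)

lemma wforms_mult:
  assumes "F \<in> wforms I wt d" "G \<in> wforms I wt e"
  shows "F * G \<in> wforms I wt (d + e)"
  unfolding wforms_def
proof (intro CollectI ballI)
  fix t assume "t \<in> Poly_Mapping.keys (F * G)"
  then obtain a b where ab: "t = a + b" "a \<in> Poly_Mapping.keys F" "b \<in> Poly_Mapping.keys G"
    using Poly_Mapping.keys_mult[of F G] by blast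
  then show "Poly_Mapping.keys t \<subseteq> I \<and> weight wt t = d + e"
    using assms Poly_Mapping.keys_add[of a b] by (fastforce simp: wforms_def weight_add)
qed

lemma wforms_Const: "Const c \<in> wforms I wt 0"
  by (auto simp: wforms_def Const_def weight_def)

lemma wforms_one: "1 \<in> wforms I wt 0"
  using wforms_Const[of 1] by (simp add: Const_hom)

lemma wforms_scale: "F \<in> wforms I wt d \<Longrightarrow> Const c * F \<in> wforms I wt d"
  using wforms_mult[OF wforms_Const] by fastforce

lemma wforms_Var: "x \<in> I \<Longrightarrow> Var x \<in> wforms I wt (wt x)"
  by (auto simp: wforms_def Var_def weight_def)

lemma wforms_power: "F \<in> wforms I wt d \<Longrightarrow> F ^ n \<in> wforms I wt (d * n)"
  by (induction n) (auto simp: wforms_one intro: wforms_mult)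

lemma wforms_sum: "(\<And>x. x \<in> S \<Longrightarrow> f x \<in> wforms I wt d) \<Longrightarrow> sum f S \<in> wforms I wt d"
  by (induction S rule: infinite_finite_induct) (auto simp: wforms_zero intro: wforms_add)

lemma wforms_prod:
  "(\<And>x. x \<in> S \<Longrightarrow> f x \<in> wforms I wt (d x)) \<Longrightarrow> prod f S \<in> wforms I wt (sum d S)"
  by (induction S rule: infinite_finite_induct) (auto simp: wforms_one intro: wforms_mult)

definition poly_subst :: "('v \<Rightarrow> ('w, 'k::field) mpoly) \<Rightarrow> ('v, 'k) mpoly \<Rightarrow> ('w, 'k) mpoly" where
  "poly_subst \<sigma> F = (\<Sum>t \<in> Poly_Mapping.keys F. Const (Poly_Mapping.lookup F t) *
                  (\<Prod>x \<in> Poly_Mapping.keys t. \<sigma> x ^ Poly_Mapping.lookup t x))"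

lemma poly_eval_poly_subst: "poly_eval a (poly_subst \<sigma> F) = poly_eval (\<lambda>x. poly_eval a (\<sigma> x)) F"
  by (simp add: poly_subst_def poly_eval_def[of _ F] poly_eval_sum poly_eval_prod)

text \<open>
  This covers both the restriction of a biform to a fibre, where one group of variables is replaced by
  constants, and the reading of a form on one factor as a biform.
\<close>

lemma wforms_poly_subst:
  assumes F: "F \<in> wforms I wt d" and \<sigma>: "\<And>x. x \<in> I \<Longrightarrow> \<sigma> x \<in> wforms J wt' (wt x)"
  shows "poly_subst \<sigma> F \<in> wforms J wt' d"
  unfolding poly_subst_def
proof (intro wforms_sum wforms_scale)
  fix t assume t: "t \<in> Poly_Mapping.keys F"
  then have "Poly_Mapping.keys t \<subseteq> I" "d = weight wt t"
    using F by (auto simp: wforms_def)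
  then show "(\<Prod>x \<in> Poly_Mapping.keys t. \<sigma> x ^ Poly_Mapping.lookup t x) \<in> wforms J wt' d"
    unfolding weight_def using \<sigma> by (auto intro!: wforms_prod wforms_power)
qed

lemma forms_eq_wforms: "forms m d = wforms {..m} (\<lambda>_. 1) d"
proof -
  have "weight (\<lambda>_. 1) t = (\<Sum>k\<le>m. Poly_Mapping.lookup t k)" if "Poly_Mapping.keys t \<subseteq> {..m}" for t
    using weight_superset[OF _ that, of "\<lambda>_. 1"] by simp
  then show ?thesis by (auto simp: forms_def wforms_def poly_ring_def)
qed

lemma finite_bivars: "finite (bivars m n)"
  by (simp add: bivars_def)

lemma biforms_eq_wforms:
  "biforms m n i j =
     wforms (bivars m n) (case_sum (\<lambda>_. 1) (\<lambda>_. 0)) i \<inter> wforms (bivars m n) (case_sum (\<lambda>_. 0) (\<lambda>_. 1)) j"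
proof -
  have "weight wt t = (\<Sum>k\<le>m. wt (Inl k) * Poly_Mapping.lookup t (Inl k)) +
                      (\<Sum>k\<le>n. wt (Inr k) * Poly_Mapping.lookup t (Inr k))"
    if "Poly_Mapping.keys t \<subseteq> bivars m n" for t wt
    using weight_superset[OF finite_bivars that, of wt] by (simp add: bivars_def sum.Plus)
  then show ?thesis by (auto simp: biforms_def wforms_def poly_ring_def)
qed

text \<open>
  The homogeneity of forms: whether a form vanishes does not depend on the coordinate vector chosen for a
  point. In a product, giving weight \<open>0\<close> to one group of variables lets the other be rescaled alone.
\<close>

lemma poly_eval_rescale:
  assumes F: "F \<in> wforms I wt d" and b: "\<And>x. x \<in> I \<Longrightarrow> b x = c ^ wt x * a x"
  shows "poly_eval b F = c ^ d * poly_eval a F"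
proof -
  have "mono_eval b t = c ^ d * mono_eval a t" if "t \<in> Poly_Mapping.keys F" for t
  proof -
    have t: "Poly_Mapping.keys t \<subseteq> I" "d = weight wt t"
      using that F by (auto simp: wforms_def)
    have "mono_eval b t = (\<Prod>x \<in> Poly_Mapping.keys t. c ^ (wt x * Poly_Mapping.lookup t x) *
                                                       a x ^ Poly_Mapping.lookup t x)"
      unfolding mono_eval_def using t(1) b
      by (intro prod.cong refl) (auto simp: subset_iff power_mult_distrib power_mult)
    then show ?thesis
      by (simp add: t(2) weight_def mono_eval_def prod.distrib power_sum)
  qed
  then show ?thesis
    by (simp add: poly_eval_eq sum_distrib_left mult_ac)
qed

section \<open>The Hilbert function as the size of an interpolation basis\<close>

definition linear_space :: "('v, 'k::field) mpoly set \<Rightarrow> bool" where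
  "linear_space E \<longleftrightarrow> 0 \<in> E \<and> (\<forall>F \<in> E. \<forall>G \<in> E. F + G \<in> E) \<and> (\<forall>F \<in> E. \<forall>c. Const c * F \<in> E)"

text \<open>
  All dimensions below are ranks of evaluation maps. Such a rank is found by choosing among the points
  of \<open>A\<close> a set \<open>B\<close> on which the space \<open>E\<close> of polynomials interpolates, and which is so large that
  vanishing on \<open>B\<close> forces vanishing on \<open>A\<close>. The points are indexed through a map \<open>e\<close> to coordinate
  vectors, so that projective points and pairs of them are covered alike.
\<close>

definition interpolation_basis ::
  "('v, 'k::field) mpoly set \<Rightarrow> ('p \<Rightarrow> 'v \<Rightarrow> 'k) \<Rightarrow> 'p set \<Rightarrow> 'p set \<Rightarrow> bool" where
  "interpolation_basis E e A B \<longleftrightarrow> B \<subseteq> A \<and>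
     (\<forall>b \<in> B. \<exists>F \<in> E. poly_eval (e b) F \<noteq> 0 \<and> (\<forall>b' \<in> B - {b}. poly_eval (e b') F = 0)) \<and>
     (\<forall>F \<in> E. (\<forall>b \<in> B. poly_eval (e b) F = 0) \<longrightarrow> (\<forall>a \<in> A. poly_eval (e a) F = 0))"

lemma interpolation_basisE:
  assumes "interpolation_basis E e A B" "b \<in> B"
  obtains F where "F \<in> E" "poly_eval (e b) F \<noteq> 0" "\<And>b'. b' \<in> B - {b} \<Longrightarrow> poly_eval (e b') F = 0"
proof -
  have "\<forall>b \<in> B. \<exists>F \<in> E. poly_eval (e b) F \<noteq> 0 \<and> (\<forall>b' \<in> B - {b}. poly_eval (e b') F = 0)"
    using assms(1) by (simp add: interpolation_basis_def)
  from bspec[OF this assms(2)] show thesis using that by auto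
qed

lemma interpolation_basis_vanish:
  assumes "interpolation_basis E e A B" "F \<in> E" "\<And>b. b \<in> B \<Longrightarrow> poly_eval (e b) F = 0" "a \<in> A"
  shows "poly_eval (e a) F = 0"
  using assms by (simp add: interpolation_basis_def)

lemma linear_space_diff:
  fixes E :: "('a, 'b::field) mpoly set"
  assumes "linear_space E" "F \<in> E" "G \<in> E"
  shows "F - G \<in> E"
proof -
  have "Const (- 1) = (- 1 :: ('a, 'b) mpoly)"
    using Const_hom(1)[of "-1" 1] by (simp add: Const_hom add_eq_0_iff2)
  then have "Const (- 1) * G = - G" by simp
  then show ?thesis
    using assms unfolding linear_space_def by (metis uminus_add_conv_diff add.commute)
qed

text \<open>
  Adding a point \<open>p\<close> enlarges an interpolation basis iff \<open>E\<close> separates \<open>p\<close> from \<open>A\<close>. This step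
  gives the existence of interpolation bases, and it compares the dimensions belonging to \<open>A\<close> and
  to \<open>insert p A\<close>.
\<close>

lemma interpolation_basis_insert:
  assumes E: "linear_space E" and basis: "interpolation_basis E e A B" and p: "p \<notin> A"
  shows "interpolation_basis E e (insert p A)
           (if \<exists>G \<in> E. poly_eval (e p) G \<noteq> 0 \<and> (\<forall>a \<in> A. poly_eval (e a) G = 0)
            then insert p B else B)"
proof (cases "\<exists>G \<in> E. poly_eval (e p) G \<noteq> 0 \<and> (\<forall>a \<in> A. poly_eval (e a) G = 0)")
  case True
  then obtain G where G: "G \<in> E" "poly_eval (e p) G \<noteq> 0" "\<forall>a \<in> A. poly_eval (e a) G = 0"
    by blast
  have B: "B \<subseteq> A" using basis by (simp add: interpolation_basis_def)
  have sep: "\<exists>F \<in> E. poly_eval (e b) F \<noteq> 0 \<and> (\<forall>b' \<in> insert p B - {b}. poly_eval (e b') F = 0)"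
    if "b \<in> insert p B" for b
  proof (cases "b = p")
    case True
    then show ?thesis using G B by blast
  next
    case False
    then obtain F where F: "F \<in> E" "poly_eval (e b) F \<noteq> 0"
        "\<And>b'. b' \<in> B - {b} \<Longrightarrow> poly_eval (e b') F = 0"
      using interpolation_basisE[OF basis, of b] \<open>b \<in> insert p B\<close> by blast
    have bA: "b \<in> A" using that False B by blast
    \<comment> \<open>subtracting a multiple of \<open>G\<close> clears the value at \<open>p\<close> and changes nothing on \<open>A\<close>\<close>
    let ?F = "F - Const (poly_eval (e p) F / poly_eval (e p) G) * G"
    have "?F \<in> E"
      using E F(1) G(1) by (intro linear_space_diff) (auto simp: linear_space_def)
    moreover have "poly_eval (e b) ?F \<noteq> 0" "\<forall>b' \<in> insert p B - {b}. poly_eval (e b') ?F = 0"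
      using F(2) F(3) G(2,3) B bA by (force, force)
    ultimately show ?thesis by blast
  qed
  have van: "poly_eval (e a) F = 0"
    if "F \<in> E" "\<forall>b \<in> insert p B. poly_eval (e b) F = 0" "a \<in> insert p A" for F a
    using that interpolation_basis_vanish[OF basis, of F a] by auto
  have "interpolation_basis E e (insert p A) (insert p B)"
    unfolding interpolation_basis_def using B sep van by (intro conjI ballI impI insert_mono) assumption+
  then show ?thesis using True by (simp only: if_True)
next
  case False
  have van: "poly_eval (e a) F = 0"
    if "F \<in> E" "\<forall>b \<in> B. poly_eval (e b) F = 0" "a \<in> insert p A" for F a
    using that interpolation_basis_vanish[OF basis, of F] False by auto
  have "interpolation_basis E e (insert p A) B"
    using basis van unfolding interpolation_basis_def by (intro conjI ballI impI subset_insertI2) simp_all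
  then show ?thesis using False by (simp only: if_False)
qed

lemma interpolation_basis_exists:
  assumes "linear_space E" "finite A"
  shows "\<exists>B. interpolation_basis E e A B"
  using assms(2)
proof (induction A rule: finite_induct)
  case empty
  show ?case by (intro exI[of _ "{}"]) (simp add: interpolation_basis_def)
next
  case (insert p A)
  then obtain B where "interpolation_basis E e A B" by blast
  from interpolation_basis_insert[OF assms(1) this insert(2)] show ?case by (rule exI)
qed

lemma poly_ring_simps [simp]:
  "mult (poly_ring I) = (*)" "one (poly_ring I) = 1" "zero (poly_ring I) = 0"
  "add (poly_ring I) = (+)"
  by (simp_all add: poly_ring_def)

lemma Const_in_carrier: "Const c \<in> carrier (poly_ring I)"
  by (auto simp: poly_ring_def Const_def)

lemma poly_ring_a_inv:
  assumes "F \<in> carrier (poly_ring I)"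
  shows "\<ominus>\<^bsub>poly_ring I\<^esub> F = - F"
proof -
  interpret R: cring "poly_ring I" by (rule cring_poly_ring)
  have "- F \<in> carrier (poly_ring I)"
    using assms by (simp add: poly_ring_def)
  then show ?thesis
    using R.minus_equality[of "- F" F] assms by simp
qed

lemma subfield_Const: "subfield (range Const) (poly_ring I :: ('v, 'k::field) mpoly ring)"
proof -
  let ?R = "poly_ring I :: ('v, 'k) mpoly ring"
  interpret R: cring ?R by (rule cring_poly_ring)
  have "subring (range Const) ?R"
  proof (rule R.subringI)
    fix F :: "('v, 'k) mpoly" assume "F \<in> range Const"
    then obtain c where "F = Const c" by blast
    then have "\<ominus>\<^bsub>?R\<^esub> F = Const (- c)"
      using poly_ring_a_inv[OF Const_in_carrier[of c I]] by (simp add: Const_def single_uminus)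
    then show "\<ominus>\<^bsub>?R\<^esub> F \<in> range Const" by simp
  next
  qed (use Const_in_carrier in \<open>auto simp flip: Const_hom\<close>)
  then have cr: "subcring (range Const) ?R"
    by (rule R.subcringI')
  have "Units (?R\<lparr>carrier := range Const\<rparr>) = range Const - {0}"
  proof (intro equalityI subsetI)
    fix F :: "('v, 'k) mpoly" assume F: "F \<in> range Const - {0}"
    then obtain c where c: "F = Const c" by blast
    with F have "c \<noteq> 0" by (auto simp: Const_hom)
    then have "Const c * Const (inverse c) = 1" "Const (inverse c) * Const c = 1"
      by (auto simp flip: Const_hom)
    then show "F \<in> Units (?R\<lparr>carrier := range Const\<rparr>)"
      using c by (auto simp: Units_def)
  qed (auto simp: Units_def)
  then show ?thesis
    using R.subfieldI[OF cr] by simp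
qed

lemma vanishing_set_ideal:
  fixes e :: "'p \<Rightarrow> 'v \<Rightarrow> 'k::field"
  shows "ideal {F \<in> carrier (poly_ring I). \<forall>a \<in> A. poly_eval (e a) F = 0} (poly_ring I)"
    (is "ideal ?Z ?R")
proof -
  interpret R: cring ?R by (rule cring_poly_ring)
  show ?thesis
  proof (rule idealI)
    show "subgroup ?Z (add_monoid ?R)"
    proof (rule R.add.subgroupI)
      have "0 \<in> ?Z" using R.zero_closed by simp
      then show "?Z \<noteq> {}" by blast
    next
      fix F assume "F \<in> ?Z"
      then show "\<ominus>\<^bsub>?R\<^esub> F \<in> ?Z"
        using R.a_inv_closed[of F] poly_ring_a_inv[of F I] by simp
    qed (use R.add.m_closed in auto)
  qed (use R.m_closed R.ring_axioms in auto)
qed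

text \<open>
  Two elements of \<open>E\<close> have the same residue class modulo the ideal generated by \<open>S\<close> iff they agree
  at all points of \<open>A\<close>, i.e. iff they agree on \<open>B\<close>. Allowing nonzero values at one more point of
  \<open>B\<close> at a time therefore builds up the image of \<open>E\<close> by one line extension per point, the new
  direction being a polynomial that separates that point from the rest of \<open>B\<close>. A point in \<open>A\<close> keeps
  the residue class ring nonzero, so that the classes of the constants form a field.
\<close>

lemma residue_dim_eq_card:
  fixes E :: "('v, 'k::field) mpoly set"
  assumes E: "linear_space E" "E \<subseteq> carrier (poly_ring I)"
    and A: "finite A" "A \<noteq> {}"
    and S: "S \<subseteq> carrier (poly_ring I)" "\<And>F a. F \<in> S \<Longrightarrow> a \<in> A \<Longrightarrow> poly_eval (e a) F = 0"
    and ES: "\<And>F. F \<in> E \<Longrightarrow> (\<And>a. a \<in> A \<Longrightarrow> poly_eval (e a) F = 0) \<Longrightarrow> F \<in> S"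
    and B: "interpolation_basis E e A B"
  shows "residue_dim I (Idl\<^bsub>poly_ring I\<^esub> S) E = card B"
proof -
  define R where "R = (poly_ring I :: ('v, 'k) mpoly ring)"
  define J where "J = Idl\<^bsub>R\<^esub> S"
  define \<phi> where "\<phi> = (\<lambda>F. J +>\<^bsub>R\<^esub> F)"
  define k where "k = \<phi> ` range Const"
  interpret R: cring R unfolding R_def by (rule cring_poly_ring)
  have SR: "S \<subseteq> carrier R" and ER: "E \<subseteq> carrier R" using S(1) E(2) by (auto simp: R_def)
  interpret J: ideal J R unfolding J_def by (rule R.genideal_ideal[OF SR])
  interpret Q: ring "R Quot J" by (rule J.quotient_is_ring)
  interpret \<phi>: ring_hom_ring R "R Quot J" \<phi>
    unfolding \<phi>_def by (rule J.rcos_ring_hom_ring)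
  \<comment> \<open>the polynomials vanishing on \<open>A\<close> form an ideal that contains the generators of \<open>J\<close>\<close>
  have J_vanish: "poly_eval (e a) F = 0" if "F \<in> J" "a \<in> A" for F a
    using R.genideal_minimal[of "{F \<in> carrier R. \<forall>a \<in> A. poly_eval (e a) F = 0}" S]
      vanishing_set_ideal[of I A e] S that unfolding J_def R_def by blast
  have E_J: "F \<in> J" if "F \<in> E" "\<And>b. b \<in> B \<Longrightarrow> poly_eval (e b) F = 0" for F
  proof -
    have "F \<in> S"
      using that ES interpolation_basis_vanish[OF B] by simp
    then show ?thesis
      using R.genideal_self[OF SR] by (auto simp: J_def)
  qed
  have \<phi>_eq_iff: "\<phi> F = \<phi> G \<longleftrightarrow> F - G \<in> J" if "F \<in> carrier R" "G \<in> carrier R" for F G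
    using R.quotient_eq_iff_same_a_r_cos[OF J.is_ideal that] that
    by (simp add: \<phi>_def a_minus_def R_def poly_ring_a_inv)
  have \<phi>_0: "\<phi> 0 = \<zero>\<^bsub>R Quot J\<^esub>"
    using \<phi>.hom_zero by (simp add: R_def)
  have "1 \<notin> J" using J_vanish[of 1] A(2) by auto
  then have "\<phi> 1 \<noteq> \<phi> 0"
    using \<phi>_eq_iff[of 1 0] R.one_closed R.zero_closed by (simp add: R_def)
  then have k: "subfield k (R Quot J)"
    unfolding k_def using \<phi>.img_is_subfield(2)[of "range Const"] subfield_Const[of I] \<phi>.hom_one \<phi>_0
    by (simp add: R_def)
  have finB: "finite B" and BA: "B \<subseteq> A"
    using B A(1) finite_subset by (auto simp: interpolation_basis_def)
  \<comment> \<open>only points of \<open>C\<close> may carry nonzero values: \<open>EC {}\<close> is zero modulo \<open>J\<close>, and \<open>EC B = E\<close>\<close>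
  define EC where "EC C = {F \<in> E. \<forall>b \<in> B - C. poly_eval (e b) F = 0}" for C
  have "Q.dimension (card C) k (\<phi> ` EC C)" if "C \<subseteq> B" for C
    using finite_subset[OF that finB] that
  proof (induction C rule: finite_induct)
    case empty
    have "\<phi> F = \<phi> 0" if "F \<in> EC {}" for F
      using that E_J[of F] \<phi>_eq_iff[of F 0] ER R.zero_closed by (auto simp: EC_def R_def)
    moreover have "0 \<in> EC {}"
      using E(1) by (simp add: EC_def linear_space_def)
    ultimately have "\<phi> ` EC {} = {\<zero>\<^bsub>R Quot J\<^esub>}"
      unfolding \<phi>_0[symmetric] by blast
    then show ?case
      using Q.zero_dim by simp
  next
    case (insert c C)
    obtain F where F: "F \<in> E" "poly_eval (e c) F \<noteq> 0"
        "\<And>b. b \<in> B - {c} \<Longrightarrow> poly_eval (e b) F = 0"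
      using interpolation_basisE[OF B, of c] insert.prems by blast
    have FR: "F \<in> carrier R" using F(1) ER by blast
    have "\<phi> F \<notin> \<phi> ` EC C"
    proof
      assume "\<phi> F \<in> \<phi> ` EC C"
      then obtain G where "G \<in> EC C" and eq: "\<phi> F = \<phi> G" by blast
      then have G: "G \<in> E" "poly_eval (e c) G = 0" "F - G \<in> J"
        using \<phi>_eq_iff[OF FR] ER insert.hyps(2) insert.prems by (auto simp: EC_def subset_iff)
      then show False
        using J_vanish[of "F - G" c] insert.prems BA F(2) by auto
    qed
    moreover have "\<phi> ` EC (insert c C) = Q.line_extension k (\<phi> F) (\<phi> ` EC C)"
    proof -
      have hom: "\<phi> (Const d) \<otimes>\<^bsub>R Quot J\<^esub> \<phi> F \<oplus>\<^bsub>R Quot J\<^esub> \<phi> G = \<phi> (Const d * F + G)"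
        if "G \<in> E" for d G
        using that FR ER Const_in_carrier[of d I] \<phi>.hom_add[of "Const d * F" G] \<phi>.hom_mult[of "Const d" F]
          R.m_closed[of "Const d" F]
        by (auto simp: R_def)
      have "Q.line_extension k (\<phi> F) (\<phi> ` EC C)
              = {\<phi> (Const d) \<otimes>\<^bsub>R Quot J\<^esub> \<phi> F \<oplus>\<^bsub>R Quot J\<^esub> \<phi> G | d G. G \<in> EC C}"
        unfolding Q.line_extension_def k_def set_add_def' r_coset_def by auto
      also have "\<dots> = \<phi> ` {Const d * F + G | d G. G \<in> EC C}"
        using hom unfolding EC_def by (auto, blast+)
      also have "{Const d * F + G | d G. G \<in> EC C} = EC (insert c C)"
      proof (intro equalityI subsetI)
        fix H assume "H \<in> {Const d * F + G | d G. G \<in> EC C}"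
        then obtain d G where "G \<in> EC C" and H: "H = Const d * F + G" by blast
        then have "H \<in> E" "\<And>b. b \<in> B - C \<Longrightarrow> poly_eval (e b) G = 0"
          using F(1) E(1) by (auto simp: EC_def linear_space_def)
        then show "H \<in> EC (insert c C)"
          using F(3) by (simp add: EC_def H)
      next
        fix H assume H: "H \<in> EC (insert c C)"
        \<comment> \<open>the multiple of \<open>F\<close> that accounts for the value of \<open>H\<close> at \<open>c\<close>\<close>
        let ?d = "poly_eval (e c) H / poly_eval (e c) F"
        have "H - Const ?d * F \<in> E"
          using H F E(1) by (intro linear_space_diff) (auto simp: EC_def linear_space_def)
        moreover have "poly_eval (e b) (H - Const ?d * F) = 0" if "b \<in> B - C" for b
          using that H F(2,3) by (cases "b = c") (auto simp: EC_def)
        ultimately have "H - Const ?d * F \<in> EC C"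
          by (simp add: EC_def)
        then show "H \<in> {Const d * F + G | d G. G \<in> EC C}"
          by (intro CollectI exI[of _ ?d] exI[of _ "H - Const ?d * F"]) simp
      qed
      finally show ?thesis by simp
    qed
    ultimately show ?case
      using Q.Suc_dim[of "\<phi> F" "\<phi> ` EC C" "card C" k] insert \<phi>.hom_closed[OF FR] by simp
  qed
  from this[of B] have "Q.dimension (card B) k (\<phi> ` E)"
    by (simp add: EC_def)
  then have "Q.dim k (\<phi> ` E) = card B"
    using Q.dimI[OF k] by (simp add: over_def)
  then show ?thesis
    by (simp add: residue_dim_def k_def \<phi>_def J_def R_def image_image)
qed


section \<open>Points of projective space and their coordinate vectors\<close>

definition rep :: "'k::field point \<Rightarrow> nat \<Rightarrow> 'k" where
  "rep p = (SOME v. v \<in> p)"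

lemma equiv_proj_rel:
  "equiv (coord_vectors m) (proj_rel m :: ((nat \<Rightarrow> 'k::field) \<times> (nat \<Rightarrow> 'k)) set)"
proof (rule equivI)
  show "(proj_rel m :: ((nat \<Rightarrow> 'k) \<times> (nat \<Rightarrow> 'k)) set) \<subseteq> coord_vectors m \<times> coord_vectors m"
    by (auto simp: proj_rel_def)
  show "refl_on (coord_vectors m) (proj_rel m :: ((nat \<Rightarrow> 'k) \<times> (nat \<Rightarrow> 'k)) set)"
    by (auto simp: refl_on_def proj_rel_def intro!: exI[of _ 1])
  show "sym (proj_rel m :: ((nat \<Rightarrow> 'k) \<times> (nat \<Rightarrow> 'k)) set)"
  proof (rule symI)
    fix v w :: "nat \<Rightarrow> 'k" assume "(v, w) \<in> proj_rel m"
    then obtain c where "c \<noteq> 0" "w = (\<lambda>i. c * v i)" "v \<in> coord_vectors m" "w \<in> coord_vectors m"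
      by (auto simp: proj_rel_def)
    then show "(w, v) \<in> proj_rel m"
      by (auto simp: proj_rel_def intro!: exI[of _ "inverse c"])
  qed
  show "trans (proj_rel m :: ((nat \<Rightarrow> 'k) \<times> (nat \<Rightarrow> 'k)) set)"
  proof (rule transI)
    fix u v w :: "nat \<Rightarrow> 'k" assume "(u, v) \<in> proj_rel m" "(v, w) \<in> proj_rel m"
    then obtain c d where "c \<noteq> 0" "v = (\<lambda>i. c * u i)" "d \<noteq> 0" "w = (\<lambda>i. d * v i)"
      "u \<in> coord_vectors m" "w \<in> coord_vectors m"
      by (auto simp: proj_rel_def)
    then show "(u, w) \<in> proj_rel m"
      by (auto simp: proj_rel_def mult.assoc intro!: exI[of _ "d * c"])
  qed
qed

lemma rep_in: "p \<in> proj_space m \<Longrightarrow> rep p \<in> p"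
  using in_quotient_imp_non_empty[OF equiv_proj_rel] unfolding proj_space_def rep_def
  by (metis ex_in_conv someI_ex)

lemma rep_coord: "p \<in> proj_space m \<Longrightarrow> rep p \<in> coord_vectors m"
  using rep_in in_quotient_imp_subset[OF equiv_proj_rel] unfolding proj_space_def by blast

lemma point_multiple_of_rep:
  assumes "p \<in> proj_space m" "v \<in> p"
  obtains c where "c \<noteq> 0" "v = (\<lambda>i. c * rep p i)"
proof -
  have "(rep p, v) \<in> proj_rel m"
    using in_quotient_imp_in_rel[OF equiv_proj_rel assms(1)[unfolded proj_space_def]]
      rep_in[OF assms(1)] assms(2) by blast
  then show thesis using that by (auto simp: proj_rel_def)
qed

lemma rep_proportional_imp_eq:
  assumes "p \<in> proj_space m" "p' \<in> proj_space m" "c \<noteq> 0" "rep p' = (\<lambda>i. c * rep p i)"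
  shows "p = p'"
proof (rule quotient_eqI[OF equiv_proj_rel])
  show "(rep p, rep p') \<in> proj_rel m"
    using assms rep_coord unfolding proj_rel_def by blast
qed (use assms(1,2) rep_in in \<open>auto simp: proj_space_def\<close>)

lemma rep_nonzero:
  assumes "p \<in> proj_space m"
  obtains k where "k \<le> m" "rep p k \<noteq> 0"
  using rep_coord[OF assms] that by (auto simp: coord_vectors_def)

lemma vanishes_at_iff:
  assumes "F \<in> forms m d" "p \<in> proj_space m"
  shows "vanishes_at F p \<longleftrightarrow> poly_eval (rep p) F = 0"
proof -
  have "poly_eval v F = 0" if v: "v \<in> p" and "poly_eval (rep p) F = 0" for v
  proof -
    obtain c where "v = (\<lambda>i. c * rep p i)"
      using point_multiple_of_rep[OF assms(2) v] .
    then show ?thesis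
      using poly_eval_rescale[of F "{..m}" "\<lambda>_. 1" d v c "rep p"] assms(1) that(2)
      by (simp add: forms_eq_wforms)
  qed
  then show ?thesis
    using rep_in[OF assms(2)] by (auto simp: vanishes_at_def)
qed

definition birep :: "'k::field point \<times> 'k point \<Rightarrow> nat + nat \<Rightarrow> 'k" where
  "birep p = case_sum (rep (fst p)) (rep (snd p))"

lemma bivanishes_at_iff:
  assumes F: "F \<in> biforms m n i j" and p: "p \<in> proj_space m \<times> proj_space n"
  shows "bivanishes_at F p \<longleftrightarrow> poly_eval (birep p) F = 0"
proof -
  have p: "fst p \<in> proj_space m" "snd p \<in> proj_space n" using p by auto
  have "poly_eval (case_sum v w) F = 0"
    if v: "v \<in> fst p" and w: "w \<in> snd p" and 0: "poly_eval (birep p) F = 0" for v w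
  proof -
    obtain c where c: "v = (\<lambda>i. c * rep (fst p) i)"
      using point_multiple_of_rep[OF p(1) v] .
    obtain d where d: "w = (\<lambda>i. d * rep (snd p) i)"
      using point_multiple_of_rep[OF p(2) w] .
    have F': "F \<in> wforms (bivars m n) (case_sum (\<lambda>_. 1) (\<lambda>_. 0)) i"
             "F \<in> wforms (bivars m n) (case_sum (\<lambda>_. 0) (\<lambda>_. 1)) j"
      using F by (auto simp: biforms_eq_wforms)
    have "poly_eval (case_sum v w) F = c ^ i * poly_eval (case_sum (rep (fst p)) w) F"
      by (rule poly_eval_rescale[OF F'(1)]) (auto simp: c split: sum.split)
    also have "poly_eval (case_sum (rep (fst p)) w) F = d ^ j * poly_eval (birep p) F"
      by (rule poly_eval_rescale[OF F'(2)]) (auto simp: d birep_def split: sum.split)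
    finally show ?thesis using 0 by simp
  qed
  then show ?thesis
    using rep_in[OF p(1)] rep_in[OF p(2)] by (auto simp: bivanishes_at_def birep_def)
qed

lemma linear_space_wforms: "linear_space (wforms I wt d)"
  by (simp add: linear_space_def wforms_zero wforms_add wforms_scale)

lemma linear_space_forms: "linear_space (forms m d)"
  by (simp add: forms_eq_wforms linear_space_wforms)

lemma linear_space_biforms: "linear_space (biforms m n i j)"
  using linear_space_wforms by (auto simp: biforms_eq_wforms linear_space_def)

lemma HF_eq_card_basis:
  assumes V: "V \<subseteq> proj_space m" "finite V" "V \<noteq> {}"
    and B: "interpolation_basis (forms m d) rep V B"
  shows "HF m V d = card B"
  unfolding HF_def vanishing_ideal_def
proof (rule residue_dim_eq_card[OF linear_space_forms _ V(2,3) _ _ _ B])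
  show "poly_eval (rep p) F = 0"
    if "F \<in> {F. (\<exists>d. F \<in> forms m d) \<and> (\<forall>p\<in>V. vanishes_at F p)}" "p \<in> V" for F p
    using that V(1) vanishes_at_iff by blast
  show "F \<in> {F. (\<exists>d. F \<in> forms m d) \<and> (\<forall>p\<in>V. vanishes_at F p)}"
    if "F \<in> forms m d" "\<And>p. p \<in> V \<Longrightarrow> poly_eval (rep p) F = 0" for F
    using that V(1) vanishes_at_iff[OF that(1)] by blast
qed (auto simp: forms_def)

lemma biHF_eq_card_basis:
  assumes X: "X \<subseteq> proj_space m \<times> proj_space n" "finite X" "X \<noteq> {}"
    and B: "interpolation_basis (biforms m n i j) birep X B"
  shows "biHF m n X i j = card B"
  unfolding biHF_def bivanishing_ideal_def
proof (rule residue_dim_eq_card[OF linear_space_biforms _ X(2,3) _ _ _ B])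
  show "poly_eval (birep p) F = 0"
    if "F \<in> {F. (\<exists>i j. F \<in> biforms m n i j) \<and> (\<forall>p\<in>X. bivanishes_at F p)}" "p \<in> X" for F p
    using that X(1) bivanishes_at_iff by blast
  show "F \<in> {F. (\<exists>i j. F \<in> biforms m n i j) \<and> (\<forall>p\<in>X. bivanishes_at F p)}"
    if "F \<in> biforms m n i j" "\<And>p. p \<in> X \<Longrightarrow> poly_eval (birep p) F = 0" for F
    using that X(1) bivanishes_at_iff[OF that(1)] by blast
qed (auto simp: biforms_def)


section \<open>Separators in a projective space\<close>

lemma separator_iff:
  assumes "V \<subseteq> proj_space m" "p \<in> V"
  shows "separator m V p d F \<longleftrightarrow> F \<in> forms m d \<and> poly_eval (rep p) F \<noteq> 0 \<and>
           (\<forall>p' \<in> V - {p}. poly_eval (rep p') F = 0)"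
  using assms vanishes_at_iff[of F m d] by (auto simp: separator_def subset_iff)

text \<open>
  Multiplying by powers of a variable that is nonzero at \<open>p\<close> keeps a separator of \<open>p\<close> a separator.
\<close>

lemma separator_raise_degree:
  assumes V: "V \<subseteq> proj_space m" "p \<in> V" and F: "separator m V p d F" and de: "d \<le> e"
  shows "\<exists>G. separator m V p e G"
proof -
  obtain k where k: "k \<le> m" "rep p k \<noteq> 0"
    using rep_nonzero V by blast
  have "F * Var k ^ (e - d) \<in> forms m (d + 1 * (e - d))"
    using F k unfolding forms_eq_wforms separator_def
    by (intro wforms_mult wforms_power wforms_Var[of k "{..m}" "\<lambda>_. 1"]) auto
  then have "separator m V p e (F * Var k ^ (e - d))"
    using F k de by (auto simp: separator_iff[OF V])
  then show ?thesis by blast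
qed

text \<open>
  Some \<open>2 \<times> 2\<close> minor of the coordinate vectors of \<open>p\<close> and \<open>p'\<close> is nonzero. With variables in place of
  the coordinates of \<open>p\<close> it becomes a linear form that vanishes at \<open>p'\<close>.
\<close>

lemma linear_separator:
  assumes p: "p \<in> proj_space m" and p': "p' \<in> proj_space m" and "p \<noteq> p'"
  obtains L where "L \<in> forms m 1" "poly_eval (rep p) L \<noteq> 0" "poly_eval (rep p') L = 0"
proof -
  obtain k where k: "k \<le> m" "rep p' k \<noteq> 0"
    using rep_nonzero[OF p'] .
  obtain l where l: "l \<le> m" "rep p l * rep p' k \<noteq> rep p k * rep p' l"
  proof (rule ccontr)
    assume "\<not> thesis"
    then have "rep p l * rep p' k = rep p k * rep p' l" if "l \<le> m" for l
      using that \<open>\<And>l. \<lbrakk>l \<le> m; rep p l * rep p' k \<noteq> rep p k * rep p' l\<rbrakk> \<Longrightarrow> thesis\<close> by blast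
    moreover have "rep p l = 0 \<and> rep p' l = 0" if "\<not> l \<le> m" for l
      using that rep_coord[OF p] rep_coord[OF p'] by (auto simp: coord_vectors_def)
    ultimately have "rep p l * rep p' k = rep p k * rep p' l" for l
      by (metis mult_zero_left mult_zero_right)
    then have eq: "rep p = (\<lambda>l. (rep p k / rep p' k) * rep p' l)"
      using k(2) by (auto simp: field_simps)
    moreover have "rep p k / rep p' k \<noteq> 0"
      using rep_nonzero[OF p] eq by (metis mult_zero_left)
    ultimately have "p' = p"
      using rep_proportional_imp_eq[OF p' p] by blast
    then show False using \<open>p \<noteq> p'\<close> by simp
  qed
  let ?L = "Const (rep p' k) * Var l - Const (rep p' l) * Var k"
  have "?L \<in> forms m 1"
    using k(1) l(1) wforms_Var[of _ "{..m}" "\<lambda>_. 1"] unfolding forms_eq_wforms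
    by (intro linear_space_diff[OF linear_space_wforms] wforms_scale) auto
  then show thesis
    using that[of ?L] l(2) by (simp add: mult.commute)
qed

lemma separating_form_exists:
  assumes "finite V" "V \<subseteq> proj_space m" "p \<in> proj_space m" "p \<notin> V"
  shows "\<exists>d. \<exists>F \<in> forms m d. poly_eval (rep p) F \<noteq> 0 \<and> (\<forall>p' \<in> V. poly_eval (rep p') F = 0)"
  using assms
proof (induction V rule: finite_induct)
  case empty
  show ?case
    using wforms_one by (intro exI[of _ 0] bexI[of _ 1]) (auto simp: forms_eq_wforms)
next
  case (insert p' V)
  then obtain d F where F: "F \<in> forms m d" "poly_eval (rep p) F \<noteq> 0" "\<forall>p' \<in> V. poly_eval (rep p') F = 0"
    by auto
  obtain L where L: "L \<in> forms m 1" "poly_eval (rep p) L \<noteq> 0" "poly_eval (rep p') L = 0"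
    using linear_separator[of p m p'] insert.prems by auto
  show ?case
    using F L wforms_mult[of F _ _ d L 1]
    by (intro exI[of _ "d + 1"] bexI[of _ "F * L"]) (auto simp: forms_eq_wforms)
qed

text \<open>
  Products of linear forms show that there are separators in some degree, and degrees can be raised.
\<close>

lemma separator_exists_iff:
  assumes V: "V \<subseteq> proj_space m" "finite V" "p \<in> V"
  shows "(\<exists>F. separator m V p d F) \<longleftrightarrow> sep_degree m V p \<le> d"
proof
  assume "\<exists>F. separator m V p d F"
  then show "sep_degree m V p \<le> d"
    unfolding sep_degree_def by (rule Least_le)
next
  have "\<exists>d F. separator m V p d F"
    using separating_form_exists[of "V - {p}" m p] V by (auto simp: separator_iff)
  then have "\<exists>F. separator m V p (sep_degree m V p) F"
    unfolding sep_degree_def by (rule LeastI_ex)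
  then show "sep_degree m V p \<le> d \<Longrightarrow> \<exists>F. separator m V p d F"
    using separator_raise_degree V by blast
qed

text \<open>
  The Hilbert function has the value \<open>card V\<close> iff all of \<open>V\<close> is an interpolation basis. This holds if
  every point has a separator, because a separator of a point outside a basis \<open>B\<close> would vanish
  on \<open>B\<close> but not on \<open>V\<close>.
\<close>

lemma HF_eq_card_iff:
  assumes V: "V \<subseteq> proj_space m" "finite V" "V \<noteq> {}"
  shows "HF m V d = card V \<longleftrightarrow> (\<forall>p \<in> V. sep_degree m V p \<le> d)"
proof -
  obtain B where B: "interpolation_basis (forms m d) rep V B"
    using interpolation_basis_exists[OF linear_space_forms V(2)] by blast
  have BV: "B \<subseteq> V" using B by (simp add: interpolation_basis_def)
  have "HF m V d = card V \<longleftrightarrow> B = V"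
    using HF_eq_card_basis[OF V B] BV card_subset_eq[OF V(2)] by auto
  also have "\<dots> \<longleftrightarrow> (\<forall>p \<in> V. \<exists>F. separator m V p d F)"
  proof
    assume "B = V"
    show "\<forall>p \<in> V. \<exists>F. separator m V p d F"
    proof
      fix p assume p: "p \<in> V"
      with interpolation_basisE[OF B] \<open>B = V\<close> obtain F where "F \<in> forms m d"
        "poly_eval (rep p) F \<noteq> 0" "\<And>p'. p' \<in> V - {p} \<Longrightarrow> poly_eval (rep p') F = 0" by blast
      then show "\<exists>F. separator m V p d F" using separator_iff[OF V(1) p] by blast
    qed
  next
    assume sep: "\<forall>p \<in> V. \<exists>F. separator m V p d F"
    have "p \<in> B" if p: "p \<in> V" for p
    proof (rule ccontr)
      assume "p \<notin> B"
      obtain F where F: "separator m V p d F" using sep p by blast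
      then have "poly_eval (rep p) F = 0"
        using \<open>p \<notin> B\<close> BV by (intro interpolation_basis_vanish[OF B _ _ p])
          (auto simp: separator_iff[OF V(1) p])
      then show False using F by (simp add: separator_iff[OF V(1) p])
    qed
    then show "B = V" using BV by blast
  qed
  also have "\<dots> \<longleftrightarrow> (\<forall>p \<in> V. sep_degree m V p \<le> d)"
    using separator_exists_iff[OF V(1,2)] by auto
  finally show ?thesis .
qed

lemma reg_index_eq_Max:
  assumes V: "V \<subseteq> proj_space m" "finite V" "V \<noteq> {}"
  shows "reg_index m V = Max (sep_degree m V ` V)"
proof -
  have "(\<forall>i\<ge>i0. HF m V i = card V) \<longleftrightarrow> Max (sep_degree m V ` V) \<le> i0" for i0
    using V by (auto simp: HF_eq_card_iff[OF V] intro: order_trans)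
  then show ?thesis
    by (simp add: reg_index_def Least_equality)
qed


section \<open>Separators in a product of two projective spaces\<close>

text \<open>
  Evaluation at one chosen pair of coordinate vectors suffices for biforms, by
  \<open>bivanishes_at_iff\<close>.
\<close>

definition biseparator ::
  "nat \<Rightarrow> nat \<Rightarrow> ('k::field point \<times> 'k point) set \<Rightarrow> 'k point \<times> 'k point \<Rightarrow> nat \<Rightarrow> nat \<Rightarrow>
     (nat + nat, 'k) mpoly \<Rightarrow> bool" where
  "biseparator m n X p i j F \<longleftrightarrow> F \<in> biforms m n i j \<and> poly_eval (birep p) F \<noteq> 0 \<and>
     (\<forall>p' \<in> X - {p}. poly_eval (birep p') F = 0)"

text \<open>
  An interpolation basis of \<open>X - {p}\<close> becomes one of \<open>X\<close> on adding \<open>p\<close> if \<open>p\<close> has a separator, and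
  is one already if not. The assumption \<open>X \<noteq> {p}\<close> keeps the residue class ring of \<open>X - {p}\<close> nonzero.
\<close>

lemma biHF_remove_point:
  assumes X: "X \<subseteq> proj_space m \<times> proj_space n" "finite X" and p: "p \<in> X" "X \<noteq> {p}"
  shows "biHF m n X i j =
           biHF m n (X - {p}) i j + (if \<exists>F. biseparator m n X p i j F then 1 else 0)"
proof -
  let ?E = "biforms m n i j"
  have X': "X - {p} \<subseteq> proj_space m \<times> proj_space n" "finite (X - {p})" "X - {p} \<noteq> {}"
    and ins: "insert p (X - {p}) = X"
    using X p by auto
  obtain B where B: "interpolation_basis ?E birep (X - {p}) B"
    using interpolation_basis_exists[OF linear_space_biforms X'(2)] by blast
  have "B \<subseteq> X - {p}" using B by (simp add: interpolation_basis_def)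
  then have fin: "finite B" "p \<notin> B" using finite_subset[OF _ X'(2)] by auto
  have "interpolation_basis ?E birep X (if \<exists>F. biseparator m n X p i j F then insert p B else B)"
    using interpolation_basis_insert[OF linear_space_biforms B, of p]
    unfolding ins biseparator_def Bex_def by simp
  then have "biHF m n X i j = card (if \<exists>F. biseparator m n X p i j F then insert p B else B)"
    using biHF_eq_card_basis[OF X] p(1) by blast
  then show ?thesis
    using biHF_eq_card_basis[OF X' B] fin by simp
qed

text \<open>
  Substituting the coordinates \<open>w\<close> for the second group of variables leaves a form in the first group.
\<close>

lemma restrict_second_factor:
  assumes F: "F \<in> biforms m n i j"
  obtains G where "G \<in> forms m i" "\<And>v. poly_eval v G = poly_eval (case_sum v w) F"
proof -
  let ?\<sigma> = "case_sum Var (\<lambda>k. Const (w k))"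
  have "poly_subst ?\<sigma> F \<in> forms m i"
    unfolding forms_eq_wforms
  proof (rule wforms_poly_subst)
    show "F \<in> wforms (bivars m n) (case_sum (\<lambda>_. 1) (\<lambda>_. 0)) i"
      using F by (simp add: biforms_eq_wforms)
    show "?\<sigma> x \<in> wforms {..m} (\<lambda>_. 1) (case_sum (\<lambda>_. 1) (\<lambda>_. 0) x)" if "x \<in> bivars m n" for x
      using that wforms_Var[of _ "{..m}" "\<lambda>_. 1"] wforms_Const by (auto simp: bivars_def)
  qed
  moreover have "poly_eval v (poly_subst ?\<sigma> F) = poly_eval (case_sum v w) F" for v
  proof -
    have "(\<lambda>x. poly_eval v (?\<sigma> x)) = case_sum v w"
      by (auto split: sum.split)
    then show ?thesis by (simp only: poly_eval_poly_subst)
  qed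
  ultimately show thesis
    by (rule that)
qed

lemma restrict_first_factor:
  assumes F: "F \<in> biforms m n i j"
  obtains G where "G \<in> forms n j" "\<And>w. poly_eval w G = poly_eval (case_sum v w) F"
proof -
  let ?\<sigma> = "case_sum (\<lambda>k. Const (v k)) Var"
  have "poly_subst ?\<sigma> F \<in> forms n j"
    unfolding forms_eq_wforms
  proof (rule wforms_poly_subst)
    show "F \<in> wforms (bivars m n) (case_sum (\<lambda>_. 0) (\<lambda>_. 1)) j"
      using F by (simp add: biforms_eq_wforms)
    show "?\<sigma> x \<in> wforms {..n} (\<lambda>_. 1) (case_sum (\<lambda>_. 0) (\<lambda>_. 1) x)" if "x \<in> bivars m n" for x
      using that wforms_Var[of _ "{..n}" "\<lambda>_. 1"] wforms_Const by (auto simp: bivars_def)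
  qed
  moreover have "poly_eval w (poly_subst ?\<sigma> F) = poly_eval (case_sum v w) F" for w
  proof -
    have "(\<lambda>x. poly_eval w (?\<sigma> x)) = case_sum v w"
      by (auto split: sum.split)
    then show ?thesis by (simp only: poly_eval_poly_subst)
  qed
  ultimately show thesis
    by (rule that)
qed

text \<open>
  The product \<open>G(x) H(y)\<close>. Each factor, written in its own group of variables, has degree zero in the other
  group.
\<close>

lemma external_product:
  assumes G: "G \<in> forms m i" and H: "H \<in> forms n j"
  obtains F where "F \<in> biforms m n i j"
    "\<And>p. poly_eval (birep p) F = poly_eval (rep (fst p)) G * poly_eval (rep (snd p)) H"
proof -
  let ?G = "poly_subst (\<lambda>k. Var (Inl k)) G" and ?H = "poly_subst (\<lambda>k. Var (Inr k)) H"
  have 0: "wforms I (\<lambda>_. 1) d \<subseteq> wforms I (\<lambda>_. 0) 0" for I :: "nat set" and d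
    by (auto simp: wforms_def weight_def)
  have Inl: "Var (Inl k) \<in> wforms (bivars m n) wt (wt (Inl k))" if "k \<in> {..m}" for k wt
    using that by (intro wforms_Var) (auto simp: bivars_def)
  have Inr: "Var (Inr k) \<in> wforms (bivars m n) wt (wt (Inr k))" if "k \<in> {..n}" for k wt
    using that by (intro wforms_Var) (auto simp: bivars_def)
  note G' = G[unfolded forms_eq_wforms] and H' = H[unfolded forms_eq_wforms]
  have "?G \<in> wforms (bivars m n) (case_sum (\<lambda>_. 1) (\<lambda>_. 0)) i"
    by (rule wforms_poly_subst[OF G']) (use Inl[of _ "case_sum (\<lambda>_. 1) (\<lambda>_. 0)"] in simp)
  moreover have "?G \<in> wforms (bivars m n) (case_sum (\<lambda>_. 0) (\<lambda>_. 1)) 0"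
    by (rule wforms_poly_subst[OF subsetD[OF 0 G']])
      (use Inl[of _ "case_sum (\<lambda>_. 0) (\<lambda>_. 1)"] in simp)
  moreover have "?H \<in> wforms (bivars m n) (case_sum (\<lambda>_. 1) (\<lambda>_. 0)) 0"
    by (rule wforms_poly_subst[OF subsetD[OF 0 H']])
      (use Inr[of _ "case_sum (\<lambda>_. 1) (\<lambda>_. 0)"] in simp)
  moreover have "?H \<in> wforms (bivars m n) (case_sum (\<lambda>_. 0) (\<lambda>_. 1)) j"
    by (rule wforms_poly_subst[OF H']) (use Inr[of _ "case_sum (\<lambda>_. 0) (\<lambda>_. 1)"] in simp)
  ultimately have "?G * ?H \<in> biforms m n i j"
    using wforms_mult[of ?G _ _ i ?H 0] wforms_mult[of ?G _ _ 0 ?H j] by (simp add: biforms_eq_wforms)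
  then show thesis
    using that[of "?G * ?H"] by (simp add: poly_eval_poly_subst birep_def)
qed

lemma mem_fibre1: "r' \<in> fibre1 X r \<longleftrightarrow> (r, r') \<in> X"
  by (force simp: fibre1_def)

lemma mem_fibre2: "r \<in> fibre2 X r' \<longleftrightarrow> (r, r') \<in> X"
  by (force simp: fibre2_def)

lemma ball_fibre1:
  "(\<forall>W \<in> fibre1 X ` fst ` X. \<forall>r' \<in> W. P W r') \<longleftrightarrow> (\<forall>p \<in> X. P (fibre1 X (fst p)) (snd p))"
proof (intro iffI ballI)
  fix p assume "\<forall>W \<in> fibre1 X ` fst ` X. \<forall>r' \<in> W. P W r'" "p \<in> X"
  then show "P (fibre1 X (fst p)) (snd p)" by (simp add: mem_fibre1)
next
  fix W r' assume P: "\<forall>p \<in> X. P (fibre1 X (fst p)) (snd p)" and "W \<in> fibre1 X ` fst ` X" "r' \<in> W"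
  then obtain r where "W = fibre1 X r" "(r, r') \<in> X" by (auto simp: mem_fibre1)
  with bspec[OF P, of "(r, r')"] show "P W r'" by simp
qed

lemma ball_fibre2:
  "(\<forall>V \<in> fibre2 X ` snd ` X. \<forall>r \<in> V. P V r) \<longleftrightarrow> (\<forall>p \<in> X. P (fibre2 X (snd p)) (fst p))"
proof (intro iffI ballI)
  fix p assume "\<forall>V \<in> fibre2 X ` snd ` X. \<forall>r \<in> V. P V r" "p \<in> X"
  then show "P (fibre2 X (snd p)) (fst p)" by (simp add: mem_fibre2)
next
  fix V r assume P: "\<forall>p \<in> X. P (fibre2 X (snd p)) (fst p)" and "V \<in> fibre2 X ` snd ` X" "r \<in> V"
  then obtain r' where "V = fibre2 X r'" "(r, r') \<in> X" by (auto simp: mem_fibre2)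
  with bspec[OF P, of "(r, r')"] show "P V r" by simp
qed

lemma fibre1_point_set:
  assumes "X \<subseteq> proj_space m \<times> proj_space n" "finite X" "r \<in> fst ` X"
  shows "fibre1 X r \<subseteq> proj_space n \<and> finite (fibre1 X r) \<and> fibre1 X r \<noteq> {}"
proof -
  obtain r' where "r' \<in> fibre1 X r" using assms(3) by (auto simp: mem_fibre1)
  then show ?thesis using assms(1,2) by (auto simp: fibre1_def)
qed

lemma fibre2_point_set:
  assumes "X \<subseteq> proj_space m \<times> proj_space n" "finite X" "r' \<in> snd ` X"
  shows "fibre2 X r' \<subseteq> proj_space m \<and> finite (fibre2 X r') \<and> fibre2 X r' \<noteq> {}"
proof -
  obtain r where "r \<in> fibre2 X r'" using assms(3) by (auto simp: mem_fibre2)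
  then show ?thesis using assms(1,2) by (auto simp: fibre2_def)
qed

text \<open>
  A separator of \<open>(q, q')\<close> restricts to separators in the two fibres through this point. For the
  converse, the star property ensures that every other point of \<open>X\<close> has its first coordinate in
  \<open>fibre2 X q' - {q}\<close> or its second coordinate in \<open>fibre1 X q - {q'}\<close>; hence the product of separators
  in the fibres vanishes there.
\<close>

lemma biseparator_exists_iff:
  assumes X: "X \<subseteq> proj_space m \<times> proj_space n" "finite X" "star_property X" and p: "(q, q') \<in> X"
  shows "(\<exists>F. biseparator m n X (q, q') i j F) \<longleftrightarrow>
           sep_degree m (fibre2 X q') q \<le> i \<and> sep_degree n (fibre1 X q) q' \<le> j"
proof -
  let ?V = "fibre2 X q'" and ?W = "fibre1 X q"
  have V: "?V \<subseteq> proj_space m" "finite ?V" "q \<in> ?V" and W: "?W \<subseteq> proj_space n" "finite ?W" "q' \<in> ?W"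
    using fibre1_point_set[OF X(1,2), of q] fibre2_point_set[OF X(1,2), of q'] p
    by (force simp: mem_fibre1 mem_fibre2)+
  have "(\<exists>F. biseparator m n X (q, q') i j F) \<longleftrightarrow>
          (\<exists>G. separator m ?V q i G) \<and> (\<exists>H. separator n ?W q' j H)"
  proof (intro iffI conjI)
    assume "\<exists>F. biseparator m n X (q, q') i j F"
    then obtain F where F: "F \<in> biforms m n i j" "poly_eval (birep (q, q')) F \<noteq> 0"
      "\<And>p. p \<in> X - {(q, q')} \<Longrightarrow> poly_eval (birep p) F = 0"
      unfolding biseparator_def by blast
    obtain G where "G \<in> forms m i" "\<And>v. poly_eval v G = poly_eval (case_sum v (rep q')) F"
      using restrict_second_factor[OF F(1)] by blast
    then have "separator m ?V q i G"
      using F(2) F(3)[of "(_, q')"] by (auto simp: separator_iff[OF V(1,3)] mem_fibre2 birep_def)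
    then show "\<exists>G. separator m ?V q i G" by blast
    obtain H where "H \<in> forms n j" "\<And>w. poly_eval w H = poly_eval (case_sum (rep q) w) F"
      using restrict_first_factor[OF F(1)] by blast
    then have "separator n ?W q' j H"
      using F(2) F(3)[of "(q, _)"] by (auto simp: separator_iff[OF W(1,3)] mem_fibre1 birep_def)
    then show "\<exists>H. separator n ?W q' j H" by blast
  next
    assume "(\<exists>G. separator m ?V q i G) \<and> (\<exists>H. separator n ?W q' j H)"
    then obtain G H where GH: "separator m ?V q i G" "separator n ?W q' j H" by blast
    then obtain F where F: "F \<in> biforms m n i j"
      "\<And>p. poly_eval (birep p) F = poly_eval (rep (fst p)) G * poly_eval (rep (snd p)) H"
      using external_product[of G m i H n j] by (auto simp: separator_def)
    have "poly_eval (birep (r, r')) F = 0"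
      if r: "(r, r') \<in> X" "(r, r') \<noteq> (q, q')" for r r'
    proof -
      have "(r, q') \<in> X \<and> r \<noteq> q \<or> (q, r') \<in> X \<and> r' \<noteq> q'"
        using X(3) p r unfolding star_property_def by blast
      then show ?thesis
        using GH by (auto simp: F(2) separator_iff[OF V(1,3)] separator_iff[OF W(1,3)]
            mem_fibre1 mem_fibre2)
    qed
    moreover have "poly_eval (birep (q, q')) F \<noteq> 0"
      using GH by (simp add: F(2) separator_iff[OF V(1,3)] separator_iff[OF W(1,3)])
    ultimately have "biseparator m n X (q, q') i j F"
      using F(1) unfolding biseparator_def by auto
    then show "\<exists>F. biseparator m n X (q, q') i j F" by blast
  qed
  then show ?thesis
    by (simp add: separator_exists_iff[OF V] separator_exists_iff[OF W])
qed

text \<open>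
  A quadrant \<open>i \<ge> a, j \<ge> b\<close> determines its corner \<open>(a, b)\<close>.
\<close>

lemma CB_property_iff:
  assumes X: "X \<subseteq> proj_space m \<times> proj_space n" "finite X" "star_property X"
  shows "CB_property m n X \<longleftrightarrow> (\<forall>p \<in> X. \<forall>p' \<in> X.
           sep_degree m (fibre2 X (snd p)) (fst p) = sep_degree m (fibre2 X (snd p')) (fst p') \<and>
           sep_degree n (fibre1 X (fst p)) (snd p) = sep_degree n (fibre1 X (fst p')) (snd p'))"
proof -
  define a where "a p = sep_degree m (fibre2 X (snd p)) (fst p)" for p
  define b where "b p = sep_degree n (fibre1 X (fst p)) (snd p)" for p
  have "biHF m n (X - {p}) = biHF m n (X - {p'}) \<longleftrightarrow> a p = a p' \<and> b p = b p'"
    if pp: "p \<in> X" "p' \<in> X" for p p'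
  proof (cases "p = p'")
    case False
    have HF: "biHF m n X i j = biHF m n (X - {r}) i j + (if a r \<le> i \<and> b r \<le> j then 1 else 0)"
      if "r \<in> {p, p'}" for r i j
    proof -
      have "r \<in> X" "X \<noteq> {r}" using pp False that by auto
      then show ?thesis
        using biHF_remove_point[OF X(1,2), of r i j] biseparator_exists_iff[OF X, of "fst r" "snd r" i j]
        by (simp add: a_def b_def)
    qed
    have "biHF m n (X - {p}) i j = biHF m n (X - {p'}) i j \<longleftrightarrow>
            (a p \<le> i \<and> b p \<le> j \<longleftrightarrow> a p' \<le> i \<and> b p' \<le> j)" for i j
      using HF[of p i j] HF[of p' i j] by (auto split: if_splits)
    then have "biHF m n (X - {p}) = biHF m n (X - {p'}) \<longleftrightarrow>
                 (\<forall>i j. a p \<le> i \<and> b p \<le> j \<longleftrightarrow> a p' \<le> i \<and> b p' \<le> j)"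
      by (simp add: fun_eq_iff)
    also have "\<dots> \<longleftrightarrow> a p = a p' \<and> b p = b p'"
      by (metis order_refl order_antisym)
    finally show ?thesis .
  qed simp
  then show ?thesis
    by (simp add: CB_property_def a_def b_def)
qed

text \<open>
  If all separator degrees of \<open>V\<close> coincide, their common value is their maximum, which is the regularity
  index.
\<close>

lemma CB_schemes_equal_reg_index_iff:
  assumes Vs: "\<And>V. V \<in> \<V> \<Longrightarrow> V \<subseteq> proj_space m \<and> finite V \<and> V \<noteq> {}"
  shows "(\<forall>V \<in> \<V>. CB_scheme m V) \<and> (\<forall>V \<in> \<V>. \<forall>V' \<in> \<V>. reg_index m V = reg_index m V') \<longleftrightarrow>
         (\<forall>V \<in> \<V>. \<forall>p \<in> V. \<forall>V' \<in> \<V>. \<forall>p' \<in> V'. sep_degree m V p = sep_degree m V' p')"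
    (is "?L \<longleftrightarrow> ?R")
proof
  assume ?L
  then show ?R unfolding CB_scheme_def by metis
next
  assume R: ?R
  have reg: "reg_index m V = sep_degree m V p" if V: "V \<in> \<V>" "p \<in> V" for V p
  proof -
    have "sep_degree m V ` V = {sep_degree m V p}"
      using R V by blast
    then show ?thesis
      using reg_index_eq_Max[of V m] Vs[OF V(1)] by simp
  qed
  have "CB_scheme m V" if "V \<in> \<V>" for V
    using reg[OF that] by (simp add: CB_scheme_def)
  moreover have "reg_index m V = reg_index m V'" if "V \<in> \<V>" "V' \<in> \<V>" for V V'
    using R reg Vs that by (metis ex_in_conv)
  ultimately show ?L by blast
qed

theorem theorem1p2:
  fixes X :: "('k::field_char_0 point \<times> 'k point) set"
    and q q' :: "nat \<Rightarrow> 'k point"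
    and W V :: "nat \<Rightarrow> 'k point set"
    and m n s1 s2 :: nat
  assumes "m \<ge> 1" and "n \<ge> 1"
    and "X \<subseteq> proj_space m \<times> proj_space n"
    and "finite X" and "X \<noteq> {}"
    and "star_property X"
    and "bij_betw q {1..s1} (fst ` X)"
    and "bij_betw q' {1..s2} (snd ` X)"
    and "\<And>i. i \<in> {1..s1} \<Longrightarrow> W i = fibre1 X (q i)"
    and "\<And>j. j \<in> {1..s2} \<Longrightarrow> V j = fibre2 X (q' j)"
  shows "CB_property m n X \<longleftrightarrow>
      ((\<forall>j \<in> {1..s2}. CB_scheme m (V j)) \<and>
       (\<forall>j \<in> {1..s2}. \<forall>j' \<in> {1..s2}. reg_index m (V j) = reg_index m (V j'))) \<and>
      ((\<forall>i \<in> {1..s1}. CB_scheme n (W i)) \<and>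
       (\<forall>i \<in> {1..s1}. \<forall>i' \<in> {1..s1}. reg_index n (W i) = reg_index n (W i')))"
proof -
  have "V ` {1..s2} = fibre2 X ` q' ` {1..s2}"
    unfolding image_image using assms(10) by (rule image_cong[OF refl])
  also have "q' ` {1..s2} = snd ` X"
    using assms(8) by (simp add: bij_betw_def)
  finally have V: "V ` {1..s2} = fibre2 X ` snd ` X" .
  have "W ` {1..s1} = fibre1 X ` q ` {1..s1}"
    unfolding image_image using assms(9) by (rule image_cong[OF refl])
  also have "q ` {1..s1} = fst ` X"
    using assms(7) by (simp add: bij_betw_def)
  finally have W: "W ` {1..s1} = fibre1 X ` fst ` X" .
  have Vs: "U \<subseteq> proj_space m \<and> finite U \<and> U \<noteq> {}" if "U \<in> V ` {1..s2}" for U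
    using that fibre2_point_set[OF assms(3,4)] unfolding V by blast
  have Ws: "U \<subseteq> proj_space n \<and> finite U \<and> U \<noteq> {}" if "U \<in> W ` {1..s1}" for U
    using that fibre1_point_set[OF assms(3,4)] unfolding W by blast
  have "(\<forall>j \<in> {1..s2}. CB_scheme m (V j)) \<and>
        (\<forall>j \<in> {1..s2}. \<forall>j' \<in> {1..s2}. reg_index m (V j) = reg_index m (V j')) \<longleftrightarrow>
        (\<forall>p \<in> X. \<forall>p' \<in> X.
           sep_degree m (fibre2 X (snd p)) (fst p) = sep_degree m (fibre2 X (snd p')) (fst p'))"
    using CB_schemes_equal_reg_index_iff[of "V ` {1..s2}" m, OF Vs]
    by (simp only: V ball_fibre2) (simp only: flip: V, simp)
  moreover have "(\<forall>i \<in> {1..s1}. CB_scheme n (W i)) \<and>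
        (\<forall>i \<in> {1..s1}. \<forall>i' \<in> {1..s1}. reg_index n (W i) = reg_index n (W i')) \<longleftrightarrow>
        (\<forall>p \<in> X. \<forall>p' \<in> X.
           sep_degree n (fibre1 X (fst p)) (snd p) = sep_degree n (fibre1 X (fst p')) (snd p'))"
    using CB_schemes_equal_reg_index_iff[of "W ` {1..s1}" n, OF Ws]
    by (simp only: W ball_fibre1) (simp only: flip: W, simp)
  ultimately show ?thesis
    using CB_property_iff[OF assms(3,4,6)] by blast
qed

end
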